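(* Let $(x_h)_{h\in\mathbb{Z}}$ be a strictly increasing sequence of real numbers. Let $F:\mathbb{R}\rightarrow\mathbb{R}$ be a non-negative function satisfying: (i) $F$ is right-continuous; (ii) $F$ assigns to intervals $]a,b]$, $a<b$, a non-negative length $\Delta F(a,b)=F(b)-F(a)\geq 0$; (iii) $F$ is constant on the intervals $]x_{h-1},x_h[$, $h\in\mathbb{Z}$; and (iv) $F$ is discontinuous at the $x_h$'s. Let $p_h$ denote the jump of $F$ at $x_h$, $h\in\mathbb{Z}$. Then: (a) for any constant-sign function $f:\mathbb{R}\rightarrow\overline{\mathbb{R}}$, the Lebesgue-Stieltjes integral of $f$ with respect to $F$ exists in $\overline{\mathbb{R}}_{+}$ or in $\overline{\mathbb{R}}_{-}$ and is given by $$\int f(x)\,dF(x)=\sum_{h\in\mathbb{Z}}p_h f(x_h);$$ (b) for any function $f:\mathbb{R}\rightarrow\overline{\mathbb{R}}$ such that $$0\leq\sum_{h\in\mathbb{Z}}p_h f^{+}(x_h)<\infty\quad\text{or}\quad 0\leq\sum_{h\in\mathbb{Z}}p_h f^{-}(x_h)<\infty,$$ the Lebesgue-Stieltjes integral of $f$ with respect to $F$ exists in $\overline{\mathbb{R}}$ and is given by the same formula $$\int f(x)\,dF(x)=\sum_{h\in\mathbb{Z}}p_h f(x_h).$$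
   Context: Notation: $\overline{\mathbb{R}}=\mathbb{R}\cup\{-\infty,+\infty\}$, $\overline{\mathbb{R}}_{+}=[0,+\infty]$, $\overline{\mathbb{R}}_{-}=[-\infty,0]$; $]a,b[$ and $]a,b]$ denote open and left-open right-closed intervals; $f^{+}=\max(f,0)$ and $f^{-}=\max(-f,0)$ are the positive and negative parts of $f$. The jump of $F$ at $x_h$ is $p_h=F(x_h)-F(x_h-0)$, where $F(x_h-0)$ is the left-hand limit of $F$ at $x_h$. The sequence $(x_h)$ may be bounded and/or finite, the notation being adapted accordingly. The Lebesgue-Stieltjes integral $\int f\,dF$ is the integral of $f$ with respect to the Lebesgue-Stieltjes measure $\lambda_F$, the measure determined by $\lambda_F(]a,b])=F(b)-F(a)$ for $a<b$.
   Formalization: When the sequence (x_h) is bounded above or below, it is additionally assumed that F is constant below all x_h and constant above all x_h, with no jump at a point above all x_h; without this the formula fails. Nothing is added if (x_h) is unbounded in both directions. *)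

theory Defs
  imports "HOL-Analysis.Analysis"
begin

(* The library measure interval_measure F lives on the Borel sets only.  The
   Lebesgue-Stieltjes measure is complete, which is what makes it possible to integrate
   functions that are not assumed to be Borel measurable. *)
definition lebesgue_stieltjes :: "(real \<Rightarrow> real) \<Rightarrow> real measure" where
  "lebesgue_stieltjes F = completion (interval_measure F)"

lemma emeasure_lebesgue_stieltjes_Ioc:
  assumes "\<And>a b. a < b \<Longrightarrow> 0 \<le> F b - F a" "\<And>a. continuous (at_right a) F" "a < b"
  shows "emeasure (lebesgue_stieltjes F) {a<..b} = ennreal (F b - F a)"
proof -
  have mono: "F x \<le> F y" if "x \<le> y" for x y
    using assms(1)[of x y] that by (cases "x = y") auto
  show ?thesis
    using emeasure_interval_measure_Ioc[of a b F] mono assms(2,3)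
    by (simp add: lebesgue_stieltjes_def)
qed

(* Since nn_integral is total (a lower integral on non-measurable functions), measurability
   is part of the existence of the integral. *)
definition has_ereal_integral ::
    "'a measure \<Rightarrow> ('a \<Rightarrow> ereal) \<Rightarrow> ereal \<Rightarrow> bool" where
  "has_ereal_integral M f v \<longleftrightarrow>
     f \<in> borel_measurable M \<and>
     ((\<integral>\<^sup>+ t. e2ennreal (max (f t) 0) \<partial>M) < \<infinity> \<or>
      (\<integral>\<^sup>+ t. e2ennreal (max (- f t) 0) \<partial>M) < \<infinity>) \<and>
     v = enn2ereal (\<integral>\<^sup>+ t. e2ennreal (max (f t) 0) \<partial>M)
         - enn2ereal (\<integral>\<^sup>+ t. e2ennreal (max (- f t) 0) \<partial>M)"

definition jump :: "(real \<Rightarrow> real) \<Rightarrow> real \<Rightarrow> real" where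
  "jump F a = F a - Lim (at_left a) F"

(* A sequence indexed by a (finite, one-sided or two-sided) block I of consecutive integers. *)
definition consecutive :: "int set \<Rightarrow> bool" where
  "consecutive I \<longleftrightarrow> (\<forall>i\<in>I. \<forall>k\<in>I. {i..k} \<subseteq> I)"

(* What replaces the missing intervals ]x_(h-1), x_h[ when the sequence is bounded on one
   side: F does not vary to the left, respectively to the right, of all the x_h.
   Both sets are empty when the sequence is unbounded in both directions.  The continuity
   clause matters only when the x_h increase to a finite limit that is not one of them:
   it excludes a jump of F at that limit. *)
definition constant_outside :: "int set \<Rightarrow> (int \<Rightarrow> real) \<Rightarrow> (real \<Rightarrow> real) \<Rightarrow> bool" where
  "constant_outside I x F \<longleftrightarrow>
     F constant_on {t. \<forall>h\<in>I. t < x h} \<and>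
     F constant_on {t. \<forall>h\<in>I. x h < t} \<and>
     (\<forall>t. (\<forall>h\<in>I. x h < t) \<longrightarrow> isCont F t)"

lemma constant_outside_unbounded:
  assumes "\<not> bdd_above (x ` I)" "\<not> bdd_below (x ` I)"
  shows "constant_outside I x F"
proof -
  have "\<exists>h\<in>I. \<not> t < x h" "\<exists>h\<in>I. \<not> x h < t" for t
    using assms unfolding bdd_above_def bdd_below_def
    by (auto simp: not_less) (meson less_le_not_le linorder_le_cases)+
  then have "{t. \<forall>h\<in>I. t < x h} = {}" "{t. \<forall>h\<in>I. x h < t} = {}"
    by blast+
  then show ?thesis
    unfolding constant_outside_def constant_on_def by blast
qed

end

theory Submission
  imports Defs
begin

text \<open>
  The measure \<open>\<lambda>\<^sub>F\<close> is carried by the countable set of the points \<open>x\<^sub>h\<close>, and there it has atoms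
  of mass \<open>p\<^sub>h\<close>; integrating against it is therefore summing against the weights \<open>p\<^sub>h\<close>.

  The mass of a point \<open>a\<close> is the limit of the masses \<open>F a - F s\<close> of the intervals from \<open>s\<close> to \<open>a\<close> as
  \<open>s\<close> increases to \<open>a\<close>. Hence it equals the jump of \<open>F\<close> at \<open>a\<close>, and it vanishes exactly when
  \<open>F\<close> is continuous at \<open>a\<close> (lemmas \<open>emeasure_singleton_eq_jump\<close> and \<open>isCont_iff_jump_eq_0\<close>); in
  particular every \<open>p\<^sub>h\<close> is strictly positive. The complement of the set of the \<open>x\<^sub>h\<close> is a countable union
  of intervals on which \<open>F\<close> is constant and at whose points it is continuous, so it is null
  (\<open>complement_of_jumps_null\<close>).

  Because \<open>\<lambda>\<^sub>F\<close> is complete and has a countable conull set with measurable points, every function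
  whatsoever is measurable for it (\<open>measurable_of_countable_conull\<close>), and
  for \<open>g \<ge> 0\<close> the integral is the sum of the \<open>p\<^sub>h g(x\<^sub>h)\<close>, by exchanging the integral with the
  sum over the atoms (\<open>nn_integral_of_countable_conull\<close>). This is applied to the positive and the negative
  part of \<open>f\<close>. If one of the two sums is finite, their difference is the unordered sum of the
  \<open>p\<^sub>h f(x\<^sub>h)\<close> (\<open>has_sum_diff_ereal\<close>), which gives (b); for a function of constant sign one of the
  parts is \<open>0\<close>, which gives (a).
\<close>

section \<open>Integration against a measure with a countable conull set\<close>

lemma nn_integral_count_space_eq_infsum:
  fixes \<phi> :: "'i \<Rightarrow> ennreal"
  assumes "countable I"
  shows "(\<integral>\<^sup>+h. \<phi> h \<partial>count_space I) = infsum \<phi> I"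
proof (cases "finite I")
  case True
  then show ?thesis by (simp add: nn_integral_count_space_finite)
next
  case False
  define e where "e = from_nat_into I"
  have e: "bij_betw e UNIV I"
    unfolding e_def using assms False by (rule bij_betw_from_nat_into)
  have "(\<integral>\<^sup>+h. \<phi> h \<partial>count_space I) = (\<Sum>n. \<phi> (e n))"
    by (simp add: nn_integral_bij_count_space[symmetric, OF e] nn_integral_count_space_nat)
  also have "\<dots> = infsum (\<lambda>n. \<phi> (e n)) UNIV"
    by (rule sums_unique[symmetric, OF has_sum_imp_sums[OF has_sum_infsum]])
      (simp add: nonneg_summable_on_complete)
  also have "\<dots> = infsum \<phi> I"
    by (rule infsum_reindex_bij_betw[OF e])
  finally show ?thesis .
qed

text \<open>
  Any subset of \<open>S\<close> is measurable because it is countable, and any subset of the complement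
  because it lies in a null set; so all subsets of the space are measurable.
\<close>

lemma (in complete_measure) measurable_of_countable_conull:
  assumes "countable S" "\<And>a. a \<in> S \<Longrightarrow> {a} \<in> sets M" "space M - S \<in> null_sets M"
    and "f \<in> space M \<rightarrow> space N"
  shows "f \<in> measurable M N"
proof (rule measurableI)
  show "f a \<in> space N" if "a \<in> space M" for a
    using assms(4) that by auto
  fix B
  have "countable (f -` B \<inter> S)"
    using assms(1) by (rule countable_subset[rotated]) auto
  then have 1: "f -` B \<inter> S \<in> sets M"
    by (rule sets.countable[rotated]) (use assms(2) in auto)
  have 2: "f -` B \<inter> (space M - S) \<in> sets M"
    using assms(3) by (intro null_setsD2[OF complete2]) auto
  have "S \<subseteq> space M"
    using assms(2)[THEN sets.sets_into_space] by auto
  then have "f -` B \<inter> space M = (f -` B \<inter> S) \<union> (f -` B \<inter> (space M - S))"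
    by auto
  then show "f -` B \<inter> space M \<in> sets M"
    using 1 2 by auto
qed

text \<open>
  Almost everywhere \<open>g\<close> is the sum of its restrictions to the points \<open>x h\<close>, and a countable sum of
  nonnegative functions may be integrated term by term.
\<close>

lemma nn_integral_of_countable_conull:
  fixes x :: "'i \<Rightarrow> 'a" and g :: "'a \<Rightarrow> ennreal"
  assumes "countable I" "inj_on x I" "\<And>h. h \<in> I \<Longrightarrow> {x h} \<in> sets M"
    and "space M - x ` I \<in> null_sets M"
    and g[measurable]: "g \<in> borel_measurable M"
  shows "(\<integral>\<^sup>+t. g t \<partial>M) = (\<Sum>\<^sub>\<infinity>h\<in>I. emeasure M {x h} * g (x h))"
proof -
  have "AE t in M. t \<in> x ` I"
    using assms(4) by (rule AE_I') auto
  moreover have "g t = (\<integral>\<^sup>+h. g t * indicator {x h} t \<partial>count_space I)" if "t \<in> x ` I" for t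
  proof -
    from that obtain k where k: "k \<in> I" "t = x k" by blast
    have "(\<integral>\<^sup>+h. g t * indicator {x h} t \<partial>count_space I) = (\<Sum>h\<in>{k}. g t * indicator {x h} t)"
      using k assms(2) by (intro nn_integral_count_space') (auto simp: inj_on_def indicator_def)
    then show ?thesis using k by simp
  qed
  ultimately have "(\<integral>\<^sup>+t. g t \<partial>M) = (\<integral>\<^sup>+t. (\<integral>\<^sup>+h. g t * indicator {x h} t \<partial>count_space I) \<partial>M)"
    by (intro nn_integral_cong_AE) (auto elim: eventually_mono)
  also have "\<dots> = (\<integral>\<^sup>+h. (\<integral>\<^sup>+t. g t * indicator {x h} t \<partial>M) \<partial>count_space I)"
    using assms(1,3) by (intro nn_integral_count_space_nn_integral) auto
  also have "\<dots> = (\<integral>\<^sup>+h. emeasure M {x h} * g (x h) \<partial>count_space I)"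
    using assms(3) by (intro nn_integral_cong) (simp add: mult.commute)
  also have "\<dots> = (\<Sum>\<^sub>\<infinity>h\<in>I. emeasure M {x h} * g (x h))"
    using assms(1) by (rule nn_integral_count_space_eq_infsum)
  finally show ?thesis .
qed

section \<open>Unordered sums of extended reals\<close>

lemma has_sum_enn2ereal:
  assumes "(\<phi> has_sum s) I"
  shows "((\<lambda>h. enn2ereal (\<phi> h)) has_sum enn2ereal s) I"
proof -
  have "((enn2ereal \<circ> \<phi>) has_sum enn2ereal s) I"
    using assms
    by (intro has_sum_comm_additive_general isContD continuous_at_enn2ereal) auto
  then show ?thesis by (simp add: o_def)
qed

text \<open>
  The sides may differ when \<open>\<infinity> - \<infinity>\<close> occurs; the last hypothesis excludes this.
\<close>

lemma ereal_add_diff_add: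
  fixes a b A B :: ereal
  assumes "0 \<le> a" "0 \<le> b" "0 \<le> A" "0 \<le> B" "a + A < \<infinity> \<or> b + B < \<infinity>"
  shows "(a - b) + (A - B) = (a + A) - (b + B)"
  using assms by (cases a; cases b; cases A; cases B) auto

text \<open>
  Subtraction of extended reals is neither additive nor continuous at \<open>\<infinity> - \<infinity>\<close>. Since one of the
  two total sums is finite and bounds all partial sums, that case arises neither for
  the finite partial sums nor in the limit.
\<close>

lemma has_sum_diff_ereal:
  fixes a b :: "'i \<Rightarrow> ereal"
  assumes "\<And>h. h \<in> I \<Longrightarrow> 0 \<le> a h" "\<And>h. h \<in> I \<Longrightarrow> 0 \<le> b h"
    and a: "(a has_sum A) I" and b: "(b has_sum B) I" and fin: "A < \<infinity> \<or> B < \<infinity>"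
  shows "((\<lambda>h. a h - b h) has_sum (A - B)) I"
proof -
  have le: "sum a J \<le> A" "sum b J \<le> B" if "finite J" "J \<subseteq> I" for J
    using that assms(1,2)
    by (auto intro!: has_sum_mono_neutral[OF has_sum_finite a] has_sum_mono_neutral[OF has_sum_finite b])
  have *: "(\<Sum>h\<in>J. a h - b h) = sum a J - sum b J" if "finite J" "J \<subseteq> I" for J
    using that
  proof (induction J)
    case (insert h J)
    have "sum a (insert h J) < \<infinity> \<or> sum b (insert h J) < \<infinity>"
      using le[OF _ insert.prems] insert.hyps fin by (auto intro: le_less_trans)
    then show ?case
      using insert assms(1,2) by (simp add: ereal_add_diff_add sum_nonneg subset_iff)
  qed simp
  have "0 \<le> A" "0 \<le> B"
    using le[of "{}"] by auto
  then have "((\<lambda>J. sum a J - sum b J) \<longlongrightarrow> A - B) (finite_subsets_at_top I)"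
    using a b fin unfolding has_sum_def by (intro tendsto_diff_ereal_general) auto
  then show ?thesis
    unfolding has_sum_def
    by (rule Lim_transform_eventually)
       (use * in \<open>auto intro: eventually_finite_subsets_at_top_weakI\<close>)
qed

section \<open>Atoms and null intervals of a Lebesgue-Stieltjes measure\<close>

lemma sets_lebesgue_stieltjes_borel:
  "A \<in> sets borel \<Longrightarrow> A \<in> sets (lebesgue_stieltjes F)"
  by (simp add: lebesgue_stieltjes_def)

lemma space_lebesgue_stieltjes [simp]: "space (lebesgue_stieltjes F) = UNIV"
  by (simp add: lebesgue_stieltjes_def)

text \<open>
  Provides the continuity required by \<open>constant_interval_null\<close> below on intervals
  without a least element.
\<close>

lemma isCont_if_constant_on_left:
  fixes F :: "real \<Rightarrow> real"
  assumes "continuous (at_right a) F" "F constant_on A" "a \<in> A" "b < a" "{b..a} \<subseteq> A"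
  shows "isCont F a"
proof -
  obtain c where c: "\<And>t. t \<in> A \<Longrightarrow> F t = c"
    using assms(2) unfolding constant_on_def by blast
  have "eventually (\<lambda>t. F t = F a) (at_left a)"
    using eventually_at_left_real[OF assms(4)]
  proof eventually_elim
    case (elim t)
    then have "t \<in> A" using assms(5) by auto
    then show ?case using c assms(3) by simp
  qed
  then have "(F \<longlongrightarrow> F a) (at_left a)"
    by (rule tendsto_eventually)
  then show ?thesis
    using assms(1) by (simp add: isCont_def filterlim_at_split continuous_within)
qed

context
  fixes F :: "real \<Rightarrow> real"
  assumes right_cont: "\<And>a. continuous (at_right a) F"
    and length_nonneg: "\<And>a b. a < b \<Longrightarrow> 0 \<le> F b - F a"
begin

lemma emeasure_singleton_finite: "emeasure (lebesgue_stieltjes F) {a} < \<infinity>"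
proof -
  have "emeasure (lebesgue_stieltjes F) {a} \<le> emeasure (lebesgue_stieltjes F) {a - 1<..a}"
    by (intro emeasure_mono sets_lebesgue_stieltjes_borel) auto
  also have "\<dots> = ennreal (F a - F (a - 1))"
    by (intro emeasure_lebesgue_stieltjes_Ioc length_nonneg right_cont) auto
  finally show ?thesis
    by (auto intro: le_less_trans)
qed

text \<open>
  Continuity from above of the measure along the intervals from \<open>s\<close> to \<open>a\<close>, which shrink to
  \<open>{a}\<close>. This also shows that the left limit in the definition of the jump exists.
\<close>

lemma tendsto_at_left_measure_singleton:
  "(F \<longlongrightarrow> F a - measure (lebesgue_stieltjes F) {a}) (at_left a)"
proof (rule tendsto_at_left_sequentially)
  let ?M = "lebesgue_stieltjes F"
  show "a - 1 < a" by simp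
  fix S assume S: "\<And>n. S n < a" "incseq S" "S \<longlonglongrightarrow> a"
  have Ioc: "emeasure ?M {S n<..a} = ennreal (F a - F (S n))" for n
    using S(1) by (intro emeasure_lebesgue_stieltjes_Ioc length_nonneg right_cont) auto
  have "(\<Inter>n. {S n<..a}) = {a}"
  proof -
    have "t = a" if "\<And>n. S n < t" "t \<le> a" for t
      using LIMSEQ_le_const2[OF S(3), of t] that by (force intro: less_imp_le)
    then show ?thesis using S(1) by auto
  qed
  moreover have "(\<lambda>n. emeasure ?M {S n<..a}) \<longlonglongrightarrow> emeasure ?M (\<Inter>n. {S n<..a})"
  proof (rule Lim_emeasure_decseq)
    show "decseq (\<lambda>n. {S n<..a})"
      using S(2) by (fastforce simp: decseq_def incseq_def)
  qed (auto simp: Ioc intro!: sets_lebesgue_stieltjes_borel)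
  ultimately have "(\<lambda>n. ennreal (F a - F (S n))) \<longlonglongrightarrow> ennreal (measure ?M {a})"
    using emeasure_singleton_finite[of a] by (simp add: Ioc emeasure_eq_ennreal_measure)
  then have "(\<lambda>n. F a - F (S n)) \<longlonglongrightarrow> measure ?M {a}"
    using length_nonneg[OF S(1)] by (subst (asm) tendsto_ennreal_iff) auto
  from tendsto_diff[OF tendsto_const[of "F a"] this]
  show "(\<lambda>n. F (S n)) \<longlonglongrightarrow> F a - measure ?M {a}"
    by simp
qed

lemma emeasure_singleton_eq_jump:
  "emeasure (lebesgue_stieltjes F) {a} = ennreal (jump F a)" "0 \<le> jump F a"
proof -
  have "Lim (at_left a) F = F a - measure (lebesgue_stieltjes F) {a}"
    by (intro tendsto_Lim tendsto_at_left_measure_singleton) simp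
  then have "jump F a = measure (lebesgue_stieltjes F) {a}"
    by (simp add: jump_def)
  then show "emeasure (lebesgue_stieltjes F) {a} = ennreal (jump F a)" "0 \<le> jump F a"
    using emeasure_singleton_finite[of a] by (simp_all add: emeasure_eq_ennreal_measure)
qed

lemma isCont_iff_jump_eq_0: "isCont F a \<longleftrightarrow> jump F a = 0"
proof -
  have *: "(F \<longlongrightarrow> F a - jump F a) (at_left a)"
    using tendsto_at_left_measure_singleton[of a] emeasure_singleton_eq_jump[of a]
    by (simp add: measure_def)
  show ?thesis
  proof
    assume "isCont F a"
    then have "(F \<longlongrightarrow> F a) (at_left a)"
      by (simp add: isCont_def filterlim_at_split)
    then show "jump F a = 0"
      using tendsto_unique[OF _ * ] by fastforce
  next
    assume "jump F a = 0"
    then show "isCont F a"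
      using * right_cont[of a] by (simp add: isCont_def filterlim_at_split continuous_within)
  qed
qed

text \<open>
  The set \<open>A\<close> is an interval of any kind. The intervals \<open>{a<..b}\<close> with rational end points in
  \<open>A\<close> are null as \<open>F\<close> does not grow on them, and they cover \<open>A\<close> up to its least and greatest
  elements. Those are null by continuity of \<open>F\<close>, which is indispensable at a least element:
  there \<open>F\<close> could jump although it is constant on \<open>A\<close>.
\<close>

lemma constant_interval_null:
  assumes const: "F constant_on A" and cont: "\<And>t. t \<in> A \<Longrightarrow> isCont F t"
    and conv: "\<And>s t. s \<in> A \<Longrightarrow> t \<in> A \<Longrightarrow> {s..t} \<subseteq> A"
  shows "\<exists>N\<in>null_sets (lebesgue_stieltjes F). A \<subseteq> N"
proof -
  let ?M = "lebesgue_stieltjes F"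
  let ?Q = "A \<inter> \<rat>"
  define E where "E = {t\<in>A. (\<forall>s\<in>A. t \<le> s) \<or> (\<forall>s\<in>A. s \<le> t)}"
  define N where "N = (\<Union>a\<in>?Q. \<Union>b\<in>?Q. {a<..b}) \<union> E"
  have Q: "countable ?Q"
    using countable_rat by (rule countable_subset[rotated]) auto
  have "{a<..b} \<in> null_sets ?M" if "a \<in> A" "b \<in> A" for a b
  proof (cases "a < b")
    case True
    have "F a = F b" using const that unfolding constant_on_def by auto
    then have "emeasure ?M {a<..b} = 0"
      using emeasure_lebesgue_stieltjes_Ioc[OF length_nonneg right_cont True] by simp
    then show ?thesis
      by (auto intro!: null_setsI sets_lebesgue_stieltjes_borel)
  qed auto
  then have "(\<Union>a\<in>?Q. \<Union>b\<in>?Q. {a<..b}) \<in> null_sets ?M"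
    using Q by (intro null_sets_UN') auto
  moreover have "E \<in> null_sets ?M"
  proof -
    \<comment> \<open>A least or greatest element is unique, so \<open>E\<close> has at most two points.\<close>
    have "{t\<in>A. \<forall>s\<in>A. t \<le> s} \<subseteq> {SOME t. t \<in> A \<and> (\<forall>s\<in>A. t \<le> s)}"
      by (smt (verit, best) insertI1 mem_Collect_eq someI_ex subsetI)
    moreover have "{t\<in>A. \<forall>s\<in>A. s \<le> t} \<subseteq> {SOME t. t \<in> A \<and> (\<forall>s\<in>A. s \<le> t)}"
      by (smt (verit, best) insertI1 mem_Collect_eq someI_ex subsetI)
    ultimately have "finite E"
      unfolding E_def by (auto intro: finite_subset simp: Collect_disj_eq conj_disj_distribL)
    moreover have "{t} \<in> null_sets ?M" if "t \<in> E" for t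
      using that cont[of t] isCont_iff_jump_eq_0[of t] emeasure_singleton_eq_jump[of t]
      by (auto simp: E_def intro!: null_setsI sets_lebesgue_stieltjes_borel)
    ultimately have "(\<Union>t\<in>E. {t}) \<in> null_sets ?M"
      by (intro null_sets_UN' countable_finite)
    then show ?thesis by simp
  qed
  ultimately have "N \<in> null_sets ?M"
    unfolding N_def by (rule null_sets.Un)
  moreover have "A \<subseteq> N"
  proof
    fix t assume t: "t \<in> A"
    show "t \<in> N"
    proof (cases "t \<in> E")
      case False
      then obtain r s where rs: "r \<in> A" "r < t" "s \<in> A" "t < s"
        using t by (auto simp: E_def not_le)
      obtain a where a: "a \<in> \<rat>" "r < a" "a < t" using Rats_dense_in_real[OF rs(2)] by blast
      obtain b where b: "b \<in> \<rat>" "t < b" "b < s" using Rats_dense_in_real[OF rs(4)] by blast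
      have "a \<in> A" "b \<in> A" using conv[OF rs(1,3)] rs a b by auto
      then show ?thesis unfolding N_def using a b by (intro UnI1 UN_I[of a] UN_I[of b]) auto
    qed (simp add: N_def)
  qed
  ultimately show ?thesis by blast
qed

end

section \<open>The jump points carry the measure\<close>

lemma between_consecutive_terms:
  fixes x :: "int \<Rightarrow> real"
  assumes "consecutive I" "i \<in> I" "k \<in> I" "x i < t" "t < x k" "strict_mono_on I x" "t \<notin> x ` I"
  shows "\<exists>h. h - 1 \<in> I \<and> h \<in> I \<and> x (h - 1) < t \<and> t < x h"
proof -
  have "i < k"
    using assms strict_mono_on_leD[OF assms(6), of k i] by (meson not_le order.strict_trans1 order_less_asym)
  have sub: "{i..k} \<subseteq> I"
    using assms(1-3) by (auto simp: consecutive_def)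
  \<comment> \<open>The sought index is the first one, from \<open>i\<close> on, whose term exceeds \<open>t\<close>.\<close>
  define H where "H = {i..k} \<inter> {h. t < x h}"
  have H: "finite H" "k \<in> H"
    using assms \<open>i < k\<close> by (auto simp: H_def)
  define h where "h = Min H"
  have h: "h \<in> H" unfolding h_def using H by (intro Min_in) auto
  moreover have "h - 1 \<notin> H"
    using Min_le[OF H(1), of "h - 1"] by (auto simp: h_def)
  moreover have "h \<noteq> i" using h assms by (auto simp: H_def)
  ultimately have "h - 1 \<in> {i..k}" "h \<in> {i..k}" "\<not> t < x (h - 1)" "t < x h"
    by (auto simp: H_def)
  moreover have "x (h - 1) \<noteq> t"
    using \<open>h - 1 \<in> {i..k}\<close> sub assms(7) by (metis imageI subsetD)
  ultimately show ?thesis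
    using sub by (intro exI[of _ h]) auto
qed

text \<open>
  A point that is no \<open>x h\<close> lies below all of them, above all of them, or between two consecutive
  ones. The first and the last kind fill intervals without a least element, on which constancy and
  right continuity yield continuity. The points above all \<open>x h\<close> may have
  a least one, the finite limit of the sequence; this is where the continuity clause of
  \<open>constant_outside\<close> enters.
\<close>

lemma complement_of_jumps_null:
  fixes x :: "int \<Rightarrow> real"
  assumes I: "consecutive I" and x: "strict_mono_on I x"
    and right_cont: "\<And>a. continuous (at_right a) F"
    and length_nonneg: "\<And>a b. a < b \<Longrightarrow> 0 \<le> F b - F a"
    and const: "\<And>h. h - 1 \<in> I \<Longrightarrow> h \<in> I \<Longrightarrow> F constant_on {x (h - 1)<..<x h}"
    and outside: "constant_outside I x F"
  shows "- x ` I \<in> null_sets (lebesgue_stieltjes F)"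
proof -
  let ?M = "lebesgue_stieltjes F"
  have null: "\<exists>N\<in>null_sets ?M. A \<subseteq> N" if "F constant_on A" "\<And>t. t \<in> A \<Longrightarrow> isCont F t"
    "\<And>s t. s \<in> A \<Longrightarrow> t \<in> A \<Longrightarrow> {s..t} \<subseteq> A" for A
    using right_cont length_nonneg that by (rule constant_interval_null)
  note isCont = isCont_if_constant_on_left[OF right_cont]
  let ?L = "{t. \<forall>h\<in>I. t < x h}" and ?U = "{t. \<forall>h\<in>I. x h < t}"
  let ?H = "{h. h - 1 \<in> I \<and> h \<in> I}"
  have L: "\<exists>N\<in>null_sets ?M. ?L \<subseteq> N"
  proof (rule null)
    show "F constant_on ?L" using outside by (simp add: constant_outside_def)
    then show "isCont F t" if "t \<in> ?L" for t
      using that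
    proof (rule isCont[where b = "t - 1"])
      show "{t - 1..t} \<subseteq> ?L"
        using that le_less_trans[of _ t] by auto
    qed simp
    show "{s..t} \<subseteq> ?L" if "t \<in> ?L" for s t
      using that le_less_trans[of _ t] by auto
  qed
  have U: "\<exists>N\<in>null_sets ?M. ?U \<subseteq> N"
  proof (rule null)
    show "F constant_on ?U" using outside by (simp add: constant_outside_def)
    show "isCont F t" if "t \<in> ?U" for t
      using outside that by (simp add: constant_outside_def)
    show "{s..t} \<subseteq> ?U" if "s \<in> ?U" for s t
      using that less_le_trans[of _ s] by auto
  qed
  have "\<exists>N\<in>null_sets ?M. {x (h - 1)<..<x h} \<subseteq> N" if "h \<in> ?H" for h
  proof (rule null)
    show c: "F constant_on {x (h - 1)<..<x h}" using const that by simp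
    show "isCont F t" if "t \<in> {x (h - 1)<..<x h}" for t
      using c that by (rule isCont[where b = "(x (h - 1) + t) / 2"]) (use that in auto)
  qed auto
  then obtain G where G: "\<And>h. h \<in> ?H \<Longrightarrow> G h \<in> null_sets ?M \<and> {x (h - 1)<..<x h} \<subseteq> G h"
    by metis
  have "- x ` I \<subseteq> ?L \<union> ?U \<union> (\<Union>h\<in>?H. {x (h - 1)<..<x h})"
  proof
    fix t assume t: "t \<in> - x ` I"
    show "t \<in> ?L \<union> ?U \<union> (\<Union>h\<in>?H. {x (h - 1)<..<x h})"
    proof (cases "t \<in> ?L \<union> ?U")
      case False
      then obtain i k where "i \<in> I" "k \<in> I" "x i < t" "t < x k"
        using t by (auto simp: not_less le_less)
      then show ?thesis
        using between_consecutive_terms[OF I, of i k x t] x t by auto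
    qed blast
  qed
  moreover obtain N1 where N1: "N1 \<in> null_sets ?M" "?L \<subseteq> N1"
    using L by blast
  moreover obtain N2 where N2: "N2 \<in> null_sets ?M" "?U \<subseteq> N2"
    using U by blast
  moreover have "(\<Union>h\<in>?H. {x (h - 1)<..<x h}) \<subseteq> (\<Union>h\<in>?H. G h)"
    by (rule UN_mono) (use G in simp_all)
  ultimately have "- x ` I \<subseteq> N1 \<union> N2 \<union> (\<Union>h\<in>?H. G h)"
    by (meson Un_mono subset_trans)
  moreover have "N1 \<union> N2 \<union> (\<Union>h\<in>?H. G h) \<in> null_sets ?M"
    by (intro null_sets.Un null_sets_UN' N1 N2 countableI_type) (use G in simp)
  ultimately show ?thesis
    unfolding lebesgue_stieltjes_def by (rule completion.complete2)
qed

section \<open>The integral as a sum over the jumps\<close>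

theorem proposition1:
  fixes I :: "int set" and x :: "int \<Rightarrow> real" and F :: "real \<Rightarrow> real" and p :: "int \<Rightarrow> real"
  assumes "consecutive I"
    and "strict_mono_on I x"
    and "\<And>t. 0 \<le> F t"
    and right_cont: "\<And>a. continuous (at_right a) F"
    and length_nonneg: "\<And>a b. a < b \<Longrightarrow> 0 \<le> F b - F a"
    and const: "\<And>h. h - 1 \<in> I \<Longrightarrow> h \<in> I \<Longrightarrow> F constant_on {x (h - 1)<..<x h}"
    and outside: "constant_outside I x F"
    and discont: "\<And>h. h \<in> I \<Longrightarrow> \<not> isCont F (x h)"
    and p: "\<And>h. h \<in> I \<Longrightarrow> p h = jump F (x h)"
  shows
    "(\<forall>f :: real \<Rightarrow> ereal.
        ((\<forall>t. 0 \<le> f t) \<longrightarrow>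
           (\<exists>v. 0 \<le> v \<and> has_ereal_integral (lebesgue_stieltjes F) f v \<and>
                ((\<lambda>h. ereal (p h) * f (x h)) has_sum v) I)) \<and>
        ((\<forall>t. f t \<le> 0) \<longrightarrow>
           (\<exists>v. v \<le> 0 \<and> has_ereal_integral (lebesgue_stieltjes F) f v \<and>
                ((\<lambda>h. ereal (p h) * f (x h)) has_sum v) I)))
     \<and>
     (\<forall>f :: real \<Rightarrow> ereal.
        (0 \<le> (\<Sum>\<^sub>\<infinity>h\<in>I. ereal (p h) * max (f (x h)) 0) \<and>
           (\<Sum>\<^sub>\<infinity>h\<in>I. ereal (p h) * max (f (x h)) 0) < \<infinity> \<or>
         0 \<le> (\<Sum>\<^sub>\<infinity>h\<in>I. ereal (p h) * max (- f (x h)) 0) \<and>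
           (\<Sum>\<^sub>\<infinity>h\<in>I. ereal (p h) * max (- f (x h)) 0) < \<infinity>) \<longrightarrow>
        (\<exists>v. has_ereal_integral (lebesgue_stieltjes F) f v \<and>
             ((\<lambda>h. ereal (p h) * f (x h)) has_sum v) I))"
proof -
  let ?M = "lebesgue_stieltjes F"
  have p_pos: "0 < p h" and mass: "emeasure ?M {x h} = ennreal (p h)" if "h \<in> I" for h
    using emeasure_singleton_eq_jump[OF right_cont length_nonneg, of "x h"]
      isCont_iff_jump_eq_0[OF right_cont length_nonneg, of "x h"] discont[OF that] p[OF that]
    by auto
  have null: "space ?M - x ` I \<in> null_sets ?M"
    using complement_of_jumps_null[OF assms(1,2) right_cont length_nonneg const outside]
    by (simp add: Compl_eq_Diff_UNIV)
  have inj: "inj_on x I" and I: "countable I"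
    using assms(2) by (auto intro: strict_mono_on_imp_inj_on)
  have sing: "{t} \<in> sets ?M" for t
    by (intro sets_lebesgue_stieltjes_borel) auto
  have meas: "f \<in> measurable ?M borel" for f :: "real \<Rightarrow> 'b::topological_space"
    using completion.measurable_of_countable_conull[of "x ` I" "interval_measure F" f borel] I sing null
    by (simp add: lebesgue_stieltjes_def)
  define integ where "integ g = enn2ereal (\<integral>\<^sup>+t. e2ennreal (g t) \<partial>?M)" for g
  have integ: "((\<lambda>h. ereal (p h) * g (x h)) has_sum integ g) I" if "\<And>t. 0 \<le> g t" for g
  proof -
    have "(\<integral>\<^sup>+t. e2ennreal (g t) \<partial>?M) = (\<Sum>\<^sub>\<infinity>h\<in>I. emeasure ?M {x h} * e2ennreal (g (x h)))"
      by (intro nn_integral_of_countable_conull I inj sing null meas)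
    then have "((\<lambda>h. emeasure ?M {x h} * e2ennreal (g (x h))) has_sum (\<integral>\<^sup>+t. e2ennreal (g t) \<partial>?M)) I"
      by (simp add: has_sum_infsum nonneg_summable_on_complete)
    from has_sum_enn2ereal[OF this] show ?thesis
      unfolding integ_def
      by (rule has_sum_cong[THEN iffD1, rotated])
        (use p_pos that in \<open>simp add: mass times_ennreal.rep_eq enn2ereal_e2ennreal less_imp_le\<close>)
  qed
  have integ_fin: "(\<integral>\<^sup>+t. e2ennreal (g t) \<partial>?M) < \<infinity> \<longleftrightarrow> integ g < \<infinity>" for g
    unfolding integ_def by (simp add: less_top[symmetric])
  \<comment> \<open>Both parts of the theorem are cases of this: all that matters is that the integral of one of
    the parts of \<open>f\<close> is finite.\<close>
  have key: "has_ereal_integral ?M f (integ (\<lambda>t. max (f t) 0) - integ (\<lambda>t. max (- f t) 0)) \<and>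
      ((\<lambda>h. ereal (p h) * f (x h)) has_sum
        (integ (\<lambda>t. max (f t) 0) - integ (\<lambda>t. max (- f t) 0))) I"
    if fin: "integ (\<lambda>t. max (f t) 0) < \<infinity> \<or> integ (\<lambda>t. max (- f t) 0) < \<infinity>" for f
  proof
    show "has_ereal_integral ?M f (integ (\<lambda>t. max (f t) 0) - integ (\<lambda>t. max (- f t) 0))"
      unfolding has_ereal_integral_def integ_fin using fin meas by (auto simp: integ_def)
    have "((\<lambda>h. ereal (p h) * max (f (x h)) 0 - ereal (p h) * max (- f (x h)) 0) has_sum
        (integ (\<lambda>t. max (f t) 0) - integ (\<lambda>t. max (- f t) 0))) I"
      using fin p_pos by (intro has_sum_diff_ereal integ ereal_0_le_mult) (auto intro: less_imp_le)
    moreover have "ereal (p h) * max y 0 - ereal (p h) * max (- y) 0 = ereal (p h) * y"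
      if "h \<in> I" for h y
      using p_pos[OF that] by (cases y) (auto simp: max_def)
    ultimately show "((\<lambda>h. ereal (p h) * f (x h)) has_sum
        (integ (\<lambda>t. max (f t) 0) - integ (\<lambda>t. max (- f t) 0))) I"
      by (simp cong: has_sum_cong)
  qed
  have integ_0: "integ (\<lambda>t. 0) = 0" and integ_nonneg: "0 \<le> integ g" for g
    by (simp_all add: integ_def zero_ennreal.rep_eq zero_ennreal.abs_eq[symmetric])
  show ?thesis
  proof (intro conjI allI impI)
    fix f :: "real \<Rightarrow> ereal" assume "\<forall>t. 0 \<le> f t"
    then have "(\<lambda>t. max (- f t) 0) = (\<lambda>t. 0)" by (auto simp: max_def fun_eq_iff intro: antisym)
    then show "\<exists>v. 0 \<le> v \<and> has_ereal_integral ?M f v \<and> ((\<lambda>h. ereal (p h) * f (x h)) has_sum v) I"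
      using key[of f] integ_0 integ_nonneg by auto
  next
    fix f :: "real \<Rightarrow> ereal" assume "\<forall>t. f t \<le> 0"
    then have "(\<lambda>t. max (f t) 0) = (\<lambda>t. 0)" by (auto simp: max_def fun_eq_iff intro: antisym)
    then show "\<exists>v. v \<le> 0 \<and> has_ereal_integral ?M f v \<and> ((\<lambda>h. ereal (p h) * f (x h)) has_sum v) I"
      using key[of f] integ_0 integ_nonneg[of "\<lambda>t. max (- f t) 0"]
      by (intro exI[of _ "- integ (\<lambda>t. max (- f t) 0)"]) auto
  next
    fix f :: "real \<Rightarrow> ereal"
    have "(\<Sum>\<^sub>\<infinity>h\<in>I. ereal (p h) * max (f (x h)) 0) = integ (\<lambda>t. max (f t) 0)"
      "(\<Sum>\<^sub>\<infinity>h\<in>I. ereal (p h) * max (- f (x h)) 0) = integ (\<lambda>t. max (- f t) 0)"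
      by (auto intro!: infsumI integ)
    moreover assume "0 \<le> (\<Sum>\<^sub>\<infinity>h\<in>I. ereal (p h) * max (f (x h)) 0) \<and>
           (\<Sum>\<^sub>\<infinity>h\<in>I. ereal (p h) * max (f (x h)) 0) < \<infinity> \<or>
         0 \<le> (\<Sum>\<^sub>\<infinity>h\<in>I. ereal (p h) * max (- f (x h)) 0) \<and>
           (\<Sum>\<^sub>\<infinity>h\<in>I. ereal (p h) * max (- f (x h)) 0) < \<infinity>"
    ultimately show "\<exists>v. has_ereal_integral ?M f v \<and> ((\<lambda>h. ereal (p h) * f (x h)) has_sum v) I"
      using key[of f] by auto
  qed
qed

end
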